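(* For $R \in [0, \frac{1}{3})$ define $$\varphi(R) = \left(\frac{\left ( 3\sqrt{\frac{1-R}{1-3R}} - 1 \right )-\sqrt{\left ( 3\sqrt{\frac{1-R}{1-3R}} - 1 \right )^2-4}}{2} \right)^{-2}-1.$$ Let $X$ be a real $3$-dimensional normed space. Suppose that there exists a subspace $Y$ of $X$ such that $\dim Y = 2$ and $\lambda(Y, X) = \frac{4}{3}-R$ for some $R \in [0,\frac13)$ satisfying $R + \varphi(R) < \frac{1}{3}$. Then there exists a $2$-dimensional subspace $Z$ of $X$ such that $$\lambda(Z, X) \leq 1 + \frac{9(R+\varphi(R))}{4-12(R+\varphi(R))}.$$
   Context: All normed spaces are real. For a subspace $Y$ of a normed space $X$, a projection from $X$ onto $Y$ is a bounded linear operator $P: X \to Y$ with $P|_Y = \mathrm{Id}_Y$; the relative projection constant $\lambda(Y,X)$ is the infimum of $\|P\|$ over all projections $P$ from $X$ onto $Y$. *)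

theory Defs
  imports "HOL-Analysis.Analysis"
begin

text \<open>The ambient normed space is the type of the points. An operator into a subspace \<open>Y\<close>
  is an operator on the whole space whose range lies in \<open>Y\<close>; the operator norm is the same.\<close>

definition projection_onto :: "('a::real_normed_vector \<Rightarrow> 'a) \<Rightarrow> 'a set \<Rightarrow> bool" where
  "projection_onto P Y \<longleftrightarrow> bounded_linear P \<and> range P \<subseteq> Y \<and> (\<forall>y\<in>Y. P y = y)"

text \<open>The infimum is taken in the reals, so the value carries no meaning when no bounded
  projection onto \<open>Y\<close> exists. This cannot happen for a subspace of finite dimension.\<close>

definition relative_projection_constant :: "'a::real_normed_vector set \<Rightarrow> real" where
  "relative_projection_constant Y = (INF P\<in>{P. projection_onto P Y}. onorm P)"

text \<open>This is used only for \<open>0 \<le> R < 1/3\<close>. Then the inner difference is at least 2, so the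
  outer square root is real and the base of the negative power is positive.\<close>

definition phi :: "real \<Rightarrow> real" where
  "phi R =
    (((3 * sqrt ((1 - R) / (1 - 3 * R)) - 1)
       - sqrt ((3 * sqrt ((1 - R) / (1 - 3 * R)) - 1)\<^sup>2 - 4)) / 2) powi (-2) - 1"

end

theory Submission imports Defs begin

text \<open>
  Write \<open>Y = ker f\<close>. Every projection onto \<open>Y\<close> has the form \<open>x \<mapsto> x - f x \<cdot> u\<close> with \<open>f u = 1\<close>. Choose
  the vector \<open>u\<close> for which its norm \<open>\<rho>\<close> is smallest. The norm is a supremum of the numbers
  \<open>g (x - f x \<cdot> u)\<close> over unit vectors \<open>x\<close> and norm-one functionals \<open>g\<close>, each of them affine in \<open>u\<close>, so at
  the minimum the gradients of the pairs that attain \<open>\<rho>\<close> have \<open>0\<close> in their convex hull. The gradients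
  live in the dual of the plane \<open>Y\<close>, so by Caratheodory's theorem three pairs \<open>(g\<^sub>i, x\<^sub>i)\<close> suffice
  (\<open>extremal_triple\<close>).

  Balancing the gradients means that \<open>f\<close> is a multiple of a convex combination \<open>\<Sum> w\<^sub>j g\<^sub>j\<close>. Inserting
  this into \<open>g\<^sub>i (x\<^sub>i - f x\<^sub>i \<cdot> u) = \<rho>\<close> gives \<open>\<rho> = g\<^sub>i x\<^sub>i - \<tau>\<^sub>i \<Sum> w\<^sub>j g\<^sub>j x\<^sub>i\<close> with \<open>\<Sum> w\<^sub>i \<tau>\<^sub>i = 1\<close>, hence
  \<open>\<rho> \<le> 1 + \<tau>\<^sub>i (1 - 2 w\<^sub>i)\<close>; if the weights are positive, equality requires \<open>g\<^sub>i x\<^sub>i = 1\<close> and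
  \<open>g\<^sub>j x\<^sub>i = -1\<close> for the other \<open>j\<close>.
  By convexity these inequalities force \<open>\<rho> \<le> 4/3\<close>. If \<open>\<rho> \<ge> 4/3 - R\<close> with small \<open>R\<close>, the weights are close
  to \<open>1/3\<close>, and all entries \<open>g\<^sub>j x\<^sub>i\<close> are within \<open>24 R\<close> of the extreme values
  (\<open>extremal_triple_defects\<close>).

  Put \<open>Z = span {x\<^sub>1, x\<^sub>2}\<close>. For the extreme values, \<open>|g\<^sub>3 (a x\<^sub>1 + b x\<^sub>2)| = |a + b|\<close> and
  \<open>|g\<^sub>1 (a x\<^sub>1 + b x\<^sub>2)| = |a - b|\<close>, so \<open>Z\<close> is isometric to the two-dimensional \<open>l\<^sub>1\<close>, which is also
  the two-dimensional \<open>l\<^sub>\<infinity>\<close> and admits a projection of norm one, built from \<open>g\<^sub>1\<close> and \<open>g\<^sub>3\<close>. The same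
  construction with perturbed entries costs a factor \<open>1 + O(R)\<close>
  (\<open>projection_onto_span_of_near_l1_pair\<close>).

  The claimed bound is of the form \<open>1 + O(R + \<phi>(R))\<close>, where \<open>\<phi>(R)\<close> is of the order of \<open>\<surd>R\<close>. The
  hypothesis \<open>R + \<phi>(R) < 1/3\<close> therefore confines \<open>R\<close> to values so small that \<open>\<phi>(R) \<ge> 33 R\<close>
  (\<open>phi_ge_linear\<close>), and the constants lost in the linear estimate are absorbed.
\<close>

section \<open>The size of the perturbation function\<close>

text \<open>
  With \<open>A = 3 \<surd>((1 - R)/(1 - 3 R)) - 1\<close>, the number \<open>s\<close> whose power defines \<open>phi\<close> is the smaller root
  of \<open>s + 1/s = A\<close>, whence \<open>phi\<^sup>2 / (1 + phi) = (1/s - s)\<^sup>2 = A\<^sup>2 - 4\<close>. The right-hand side grows at least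
  linearly in \<open>R\<close>, with slope near \<open>12\<close>, so \<open>phi\<^sup>2\<close> does as well; together with \<open>phi < 1/3\<close> this bounds
  \<open>phi\<close> itself below by a multiple of \<open>R\<close>.
\<close>
lemma phi_ge_linear:
  assumes "0 \<le> R" "R < 1 / 3" "R + phi R < 1 / 3"
  shows "33 * R \<le> phi R"
proof -
  define K where "K = (1 - R) / (1 - 3 * R)"
  define A where "A = 3 * sqrt K - 1"
  define s where "s = (A - sqrt (A\<^sup>2 - 4)) / 2"
  have K: "1 + 2 * R \<le> K"
    using assms by (simp add: K_def field_simps)
  then have "1 \<le> sqrt K" using assms by simp
  then have A: "2 \<le> A" by (simp add: A_def)
  have sq: "(sqrt (A\<^sup>2 - 4))\<^sup>2 = A\<^sup>2 - 4"
    using A power_mono[of 2 A 2] by simp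
  have s1: "s \<le> 1"
  proof -
    have "(A - 2)\<^sup>2 \<le> A\<^sup>2 - 4"
      using A by (simp add: power2_eq_square algebra_simps)
    then have "A - 2 \<le> sqrt (A\<^sup>2 - 4)" by (rule real_le_rsqrt)
    then show ?thesis by (simp add: s_def)
  qed
  have s0: "0 < s"
  proof -
    have "sqrt (A\<^sup>2 - 4) < A" using A by (intro real_less_lsqrt) auto
    then show ?thesis by (simp add: s_def)
  qed
  have quad: "s\<^sup>2 + 1 = A * s"
  proof -
    define D where "D = sqrt (A\<^sup>2 - 4)"
    have "4 * s\<^sup>2 = A\<^sup>2 - 2 * A * D + D\<^sup>2"
      by (simp add: s_def D_def [symmetric] power_divide power2_diff)
    moreover have "D\<^sup>2 = A\<^sup>2 - 4" using sq by (simp only: D_def)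
    moreover have "2 * s = A - D" by (simp add: s_def D_def)
    ultimately show ?thesis by algebra
  qed
  have phi: "phi R = 1 / s\<^sup>2 - 1"
    unfolding phi_def K_def [symmetric] A_def [symmetric] s_def [symmetric]
    by (simp add: power_int_minus divide_inverse)
  have phi0: "0 \<le> phi R"
    using s0 s1 power_le_one[of s 2] by (simp add: phi)
  have "(phi R)\<^sup>2 = (1 + phi R) * (A\<^sup>2 - 4)"
  proof -
    have A_eq: "A = (s\<^sup>2 + 1) / s" using quad s0 by (simp add: field_simps)
    show ?thesis using s0 unfolding phi A_eq
      by (simp add: field_simps power2_eq_square)
  qed
  moreover have "0 \<le> A\<^sup>2 - 4" using power_mono[of 2 A 2] A by simp
  ultimately have "A\<^sup>2 - 4 \<le> (phi R)\<^sup>2" 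
    using phi0 mult_right_mono[of 1 "1 + phi R" "A\<^sup>2 - 4"] by simp
  moreover have "4 * (A - 2) \<le> A\<^sup>2 - 4"
    using mult_mono[of 2 A "A - 2" "A - 2"] zero_le_power2[of "A - 2"]
    by (simp add: power2_eq_square algebra_simps)
  ultimately have lo: "12 * (sqrt K - 1) \<le> (phi R)\<^sup>2" by (simp add: A_def)
  \<comment> \<open>Feeding the upper bound on \<open>phi\<close> back bounds \<open>sqrt K\<close> above, so that \<open>sqrt K - 1\<close> is comparable to \<open>K - 1\<close>.\<close>
  have up: "3 * (phi R)\<^sup>2 \<le> phi R"
    using phi0 assms mult_right_mono[of "3 * phi R" 1 "phi R"] by (simp add: power2_eq_square)
  have "(phi R)\<^sup>2 \<le> 1 / 9" using up assms by linarith
  with lo have "12 * (sqrt K - 1) \<le> 1 / 9" by (rule order_trans)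
  then have small: "sqrt K - 1 \<le> 1 / 108" by (simp add: field_simps)
  have "2 * R \<le> K - 1" using K by simp
  also have "K - 1 = (sqrt K - 1) * (sqrt K + 1)"
    using K assms by (simp add: algebra_simps)
  also have "\<dots> \<le> (sqrt K - 1) * (217 / 108)"
    using small \<open>1 \<le> sqrt K\<close> by (intro mult_left_mono) auto
  finally show ?thesis using lo up assms by linarith
qed

section \<open>Minimisers of suprema of affine functions\<close>

text \<open>
  The first-order condition for minimising a supremum of affine functions. The coercivity hypothesis
  provides a minimiser \<open>u\<close>, with value \<open>\<rho>\<close>. If \<open>(0, \<rho>)\<close> were not in the convex hull of the points
  \<open>(b k, a k + b k \<bullet> u)\<close>, a separating hyperplane would give a direction in which the supremum
  decreases. Since no point of this hull lies above the level \<open>\<rho>\<close>, a convex combination that yields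
  \<open>(0, \<rho>)\<close> can only use points on that level, that is, indices \<open>k\<close> at which the supremum is attained.
\<close>
lemma affine_sup_minimiser:
  fixes K :: "'k::topological_space set" and a :: "'k \<Rightarrow> real"
    and b :: "'k \<Rightarrow> 'e::euclidean_space"
  assumes K: "compact K" and ca: "continuous_on K a" and cb: "continuous_on K b"
    and m: "0 < m" and coercive: "\<And>u. \<exists>k\<in>K. m * norm u \<le> b k \<bullet> u"
  obtains u \<rho> where "\<And>k. k \<in> K \<Longrightarrow> a k + b k \<bullet> u \<le> \<rho>"
    and "0 \<in> convex hull (b ` {k \<in> K. a k + b k \<bullet> u = \<rho>})"
proof -
  have ne: "K \<noteq> {}" using coercive by blast
  have cont: "continuous_on K (\<lambda>k. a k + b k \<bullet> u)" for u
    by (intro continuous_intros ca cb)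
  define F where "F u = (SUP k\<in>K. a k + b k \<bullet> u)" for u
  have att: "\<exists>k\<in>K. F u = a k + b k \<bullet> u \<and> (\<forall>l\<in>K. a l + b l \<bullet> u \<le> F u)" for u
  proof -
    obtain k where k: "k \<in> K" "\<And>l. l \<in> K \<Longrightarrow> a l + b l \<bullet> u \<le> a k + b k \<bullet> u"
      using continuous_attains_sup[OF K ne cont[of u]] by blast
    then have "F u = a k + b k \<bullet> u"
      unfolding F_def by (intro cSup_eq_maximum) auto
    with k show ?thesis by auto
  qed
  then have F_ge: "a k + b k \<bullet> u \<le> F u" if "k \<in> K" for k u using that by blast
  have F_att: "\<exists>k\<in>K. F u = a k + b k \<bullet> u" for u using att by blast
  have "convex_on UNIV F"
  proof (rule convex_onI)
    fix t :: real and x y :: 'e assume t: "0 < t" "t < 1"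
    obtain k where k: "k \<in> K" "F ((1 - t) *\<^sub>R x + t *\<^sub>R y) = a k + b k \<bullet> ((1 - t) *\<^sub>R x + t *\<^sub>R y)"
      using F_att by blast
    have "a k + b k \<bullet> ((1 - t) *\<^sub>R x + t *\<^sub>R y)
      = (1 - t) * (a k + b k \<bullet> x) + t * (a k + b k \<bullet> y)"
      by (simp add: inner_add_right algebra_simps)
    also have "\<dots> \<le> (1 - t) * F x + t * F y"
      using t F_ge[OF k(1)] by (intro add_mono mult_left_mono) auto
    finally show "F ((1 - t) *\<^sub>R x + t *\<^sub>R y) \<le> (1 - t) * F x + t * F y" using k by simp
  qed auto
  then have contF: "continuous_on UNIV F" by (intro convex_on_continuous) auto
  obtain l where l: "l \<in> K" "\<And>k. k \<in> K \<Longrightarrow> a l \<le> a k"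
    using continuous_attains_inf[OF K ne ca] by blast
  \<comment> \<open>Outside this ball coercivity makes \<open>F\<close> at least \<open>F 0\<close>.\<close>
  define r where "r = \<bar>F 0 - a l\<bar> / m"
  obtain u where u: "u \<in> cball 0 r" "\<And>v. v \<in> cball 0 r \<Longrightarrow> F u \<le> F v"
  proof -
    have "cball (0::'e) r \<noteq> {}" using divide_nonneg_pos[OF abs_ge_zero m] by (simp add: r_def not_less)
    then show thesis
      using continuous_attains_inf[OF compact_cball _ continuous_on_subset[OF contF subset_UNIV]] that
      by meson
  qed
  have min: "F u \<le> F v" for v
  proof (cases "v \<in> cball 0 r")
    case False
    obtain k where k: "k \<in> K" "m * norm v \<le> b k \<bullet> v" using coercive by blast
    have "F u \<le> F 0" using u(2)[of 0] m by (simp add: r_def)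
    also have "\<dots> \<le> a l + m * r" using m by (simp add: r_def)
    also have "\<dots> \<le> a k + m * norm v"
      using l(2)[OF k(1)] False m by (intro add_mono mult_left_mono) auto
    also have "\<dots> \<le> F v" using F_ge[OF k(1), of v] k(2) by linarith
    finally show ?thesis .
  qed (use u in auto)
  define c where "c k = (b k, a k + b k \<bullet> u)" for k
  have C: "compact (convex hull (c ` K))"
    unfolding c_def
    by (intro compact_convex_hull compact_continuous_image K continuous_intros ca cb)
  have "(0, F u) \<in> convex hull (c ` K)"
  proof (rule ccontr)
    assume "(0, F u) \<notin> convex hull (c ` K)"
    then obtain ys \<theta> where sep: "ys \<bullet> (0, F u) < \<theta>" "\<And>x. x \<in> convex hull (c ` K) \<Longrightarrow> ys \<bullet> x > \<theta>"
      using separating_hyperplane_closed_point[of "convex hull (c ` K)" "(0, F u)"]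
        compact_imp_closed[OF C] convex_convex_hull by meson
    obtain y s where ys: "ys = (y, s)" by (cases ys)
    have s0: "s * F u < \<theta>" using sep(1) by (simp add: ys)
    \<comment> \<open>A step so short that the factor \<open>1 + \<epsilon> * s\<close> stays nonnegative; the sign of \<open>s\<close> is not known.\<close>
    define \<epsilon> where "\<epsilon> = 1 / (1 + \<bar>s\<bar>)"
    have e: "0 < \<epsilon>" "0 \<le> 1 + \<epsilon> * s" by (auto simp: \<epsilon>_def divide_simps)
    obtain k where k: "k \<in> K" "F (u - \<epsilon> *\<^sub>R y) = a k + b k \<bullet> (u - \<epsilon> *\<^sub>R y)" using F_att by blast
    define d where "d = a k + b k \<bullet> u"
    have "\<theta> < y \<bullet> b k + s * d"
      using sep(2)[of "c k"] k(1) by (simp add: ys c_def d_def hull_inc)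
    then have "\<epsilon> * (\<theta> - s * d) < \<epsilon> * (y \<bullet> b k)" using e by simp
    moreover have "F (u - \<epsilon> *\<^sub>R y) = d - \<epsilon> * (y \<bullet> b k)"
      by (simp add: k d_def inner_diff_right inner_commute)
    moreover have "d * (1 + \<epsilon> * s) \<le> F u * (1 + \<epsilon> * s)"
      using F_ge[OF k(1), of u] e by (intro mult_right_mono) (auto simp: d_def)
    moreover have "\<epsilon> * (s * F u) < \<epsilon> * \<theta>" using s0 e by simp
    ultimately have "F (u - \<epsilon> *\<^sub>R y) < F u" by (simp add: algebra_simps)
    with min show False by (simp add: leD)
  qed
  then obtain S w where S: "finite S" "S \<subseteq> c ` K" "\<And>x. x \<in> S \<Longrightarrow> 0 \<le> w x" "sum w S = 1"
      and eq: "(\<Sum>x\<in>S. w x *\<^sub>R x) = (0, F u)"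
    unfolding convex_hull_explicit by auto
  have snd_le: "snd x \<le> F u" if "x \<in> S" for x
    using that S(2) F_ge by (auto simp: c_def)
  have "(\<Sum>x\<in>S. w x * (F u - snd x)) = 0"
  proof -
    have "(\<Sum>x\<in>S. w x * snd x) = F u"
      using arg_cong[OF eq, of snd] by (simp add: snd_sum)
    then show ?thesis by (simp add: right_diff_distrib sum_subtractf flip: sum_distrib_right) (simp add: S)
  qed
  then have act: "w x = 0 \<or> snd x = F u" if "x \<in> S" for x
    using that S snd_le sum_nonneg_eq_0_iff[of S "\<lambda>x. w x * (F u - snd x)"] by auto
  define S' where "S' = {x \<in> S. w x \<noteq> 0}"
  have S': "finite S'" "S' \<subseteq> S" using S(1) by (auto simp: S'_def)
  have "(\<Sum>x\<in>S'. w x *\<^sub>R fst x) \<in> convex hull (b ` {k \<in> K. a k + b k \<bullet> u = F u})"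
  proof (rule convex_sum)
    have "sum w S' = sum w S"
      using S(1) S' by (intro sum.mono_neutral_left) (auto simp: S'_def)
    then show "sum w S' = 1" by (simp add: S(4))
    fix x assume x: "x \<in> S'"
    then show "0 \<le> w x" using S(3) S'(2) by blast
    from x obtain k where "k \<in> K" "x = c k" using S(2) S'(2) by blast
    with x act[of x] show "fst x \<in> convex hull (b ` {k \<in> K. a k + b k \<bullet> u = F u})"
      by (intro hull_inc) (auto simp: S'_def c_def)
  qed (use S'(1) in auto)
  moreover have "(\<Sum>x\<in>S'. w x *\<^sub>R fst x) = (\<Sum>x\<in>S. w x *\<^sub>R fst x)"
    using S(1) by (intro sum.mono_neutral_left) (auto simp: S'_def)
  moreover have "\<dots> = 0"
    using arg_cong[OF eq, of fst] by (simp add: fst_sum)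
  ultimately have "0 \<in> convex hull (b ` {k \<in> K. a k + b k \<bullet> u = F u})" by simp
  then show ?thesis using that F_ge by blast
qed

section \<open>Three extremal pairs for a minimal projection onto a plane\<close>

text \<open>
  The Hahn-Banach theorem for a seminorm on a Euclidean space: a hyperplane that separates \<open>z\<close>, scaled
  to seminorm one, from the open unit ball.
\<close>
lemma norming_vector_exists:
  fixes T :: "'e::euclidean_space \<Rightarrow> 'a::real_normed_vector"
  assumes T: "linear T"
  obtains g where "\<And>v. g \<bullet> v \<le> norm (T v)" and "g \<bullet> z = norm (T z)"
proof (cases "T z = 0")
  case True
  then show thesis using that[of 0] by simp
next
  case False
  interpret T: linear T by fact
  define y where "y = (1 / norm (T z)) *\<^sub>R z"
  have y: "norm (T y) = 1" using False by (simp add: y_def T.scale)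
  have eq: "{v. norm (T v) < 1} = T -` ball 0 1" by auto
  have "convex {v. norm (T v) < 1}"
    unfolding eq using T by (intro convex_linear_vimage) auto
  moreover have "0 \<in> {v. norm (T v) < 1}" by (simp add: T.zero)
  ultimately obtain a b where a: "a \<noteq> 0" and sep: "\<And>x. norm (T x) < 1 \<Longrightarrow> a \<bullet> x \<le> b" "b \<le> a \<bullet> y"
    using separating_hyperplane_sets[of "{v. norm (T v) < 1}" "{y}"] y by auto
  have scaled: "a \<bullet> v \<le> t * (a \<bullet> y)" if "norm (T v) < t" for v t
  proof -
    have t: "0 < t" using that norm_ge_zero[of "T v"] by linarith
    have "a \<bullet> ((1 / t) *\<^sub>R v) \<le> a \<bullet> y"
      using sep t that by (intro order_trans[OF sep]) (auto simp: T.scale)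
    with t show ?thesis by (simp add: field_simps)
  qed
  have "0 < a \<bullet> y"
  proof -
    have "0 < a \<bullet> a" using a by simp
    also have "\<dots> \<le> (norm (T a) + 1) * (a \<bullet> y)" by (rule scaled) simp
    finally show ?thesis
      using norm_ge_zero[of "T a"] by (simp add: zero_less_mult_iff)
  qed
  define g where "g = (1 / (a \<bullet> y)) *\<^sub>R a"
  have "g \<bullet> v \<le> norm (T v)" for v
  proof (rule field_le_epsilon)
    fix e :: real assume "0 < e"
    then show "g \<bullet> v \<le> norm (T v) + e"
      using scaled[of v "norm (T v) + e"] \<open>0 < a \<bullet> y\<close> by (simp add: g_def field_simps)
  qed
  moreover have "g \<bullet> z = norm (T z)"
  proof -
    have "g \<bullet> y = 1" using \<open>0 < a \<bullet> y\<close> by (simp add: g_def)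
    then show ?thesis using False by (simp add: y_def)
  qed
  ultimately show thesis by (rule that)
qed

text \<open>
  Compactness, separation and Caratheodory's theorem are applied in a Euclidean space and carried over
  to the given space by this isomorphism. The plane corresponds to the first factor, so that
  the functional with kernel \<open>Y\<close> is the second projection.
\<close>
lemma coordinates_adapted_to_plane:
  fixes Y :: "'a::real_normed_vector set"
  assumes "dim (UNIV :: 'a set) = 3" "subspace Y" "dim Y = 2"
  obtains T :: "(real \<times> real) \<times> real \<Rightarrow> 'a"
  where "linear T" "bij T" "\<And>v. T v \<in> Y \<longleftrightarrow> snd v = 0"
proof -
  obtain A where A: "A \<subseteq> Y" "independent A" "Y \<subseteq> span A" "card A = 2"
    using basis_exists[of Y] assms(3) by metis
  obtain B where B: "A \<subseteq> B" "independent B" "UNIV \<subseteq> span B"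
    using maximal_independent_subset_extend[OF subset_UNIV A(2)] by metis
  have card: "card B = 3" using basis_card_eq_dim[OF subset_UNIV B(3,2)] assms(1) by simp
  have fin: "finite B" using card by (intro card_ge_0_finite) simp
  obtain p q where pq: "A = {p, q}" "p \<noteq> q" using A(4) by (auto simp: card_2_iff)
  have "card (B - A) = 1"
    using card A(4) B(1) fin by (simp add: card_Diff_subset finite_subset)
  then obtain e where "B - A = {e}" by (auto simp: card_1_singleton_iff)
  then have Beq: "B = {p, q, e}" and e: "e \<noteq> p" "e \<noteq> q" using pq B(1) by auto
  define T :: "(real \<times> real) \<times> real \<Rightarrow> 'a"
    where "T v = fst (fst v) *\<^sub>R p + snd (fst v) *\<^sub>R q + snd v *\<^sub>R e" for v
  have lin: "linear T"
    by (rule linearI) (simp_all add: T_def algebra_simps)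
  interpret T: linear T by (rule lin)
  have "inj T"
    unfolding T.inj_iff_eq_0
  proof (intro allI impI)
    fix v assume 0: "T v = 0"
    define c where "c = (\<lambda>x. if x = p then fst (fst v) else if x = q then snd (fst v) else snd v)"
    have "(\<Sum>x\<in>B. c x *\<^sub>R x) = 0"
      using 0 pq e by (simp add: Beq c_def T_def add.assoc)
    then have "c x = 0" if "x \<in> B" for x
      using independentD[OF B(2) fin subset_refl] that by blast
    from this[of p] this[of q] this[of e] show "v = 0"
      using pq e by (auto simp: Beq c_def prod_eq_iff)
  qed
  moreover have "surj T"
  proof -
    have "x \<in> range T" for x
    proof -
      have "x \<in> span {p, q, e}" using B(3) Beq by blast
      then obtain a b c where "x - a *\<^sub>R p - b *\<^sub>R q - c *\<^sub>R e = 0"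
        by (auto simp: span_breakdown_eq)
      then have "x = T ((a, b), c)" by (simp add: T_def algebra_simps)
      then show ?thesis by blast
    qed
    then show ?thesis by blast
  qed
  moreover have "T v \<in> Y \<longleftrightarrow> snd v = 0" for v
  proof -
    have "span A = Y" using A assms(2) by (metis span_minimal subset_antisym)
    have *: "fst (fst v) *\<^sub>R p + snd (fst v) *\<^sub>R q \<in> Y"
      using A(1) pq assms(2) by (auto intro!: subspace_add subspace_scale)
    have "e \<notin> span A"
      using B(2) e pq(1) unfolding Beq
      by (metis insert_commute independent_insert insert_iff singleton_iff)
    then have "snd v *\<^sub>R e \<in> Y \<longleftrightarrow> snd v = 0"
      using \<open>span A = Y\<close> span_scale[of "snd v *\<^sub>R e" A "1 / snd v"] assms(2)
      by (auto simp: subspace_0 split: if_splits)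
    then show ?thesis
      using * assms(2) unfolding T_def by (metis add_diff_cancel_left' subspace_add subspace_diff)
  qed
  ultimately show thesis using that lin by (simp add: bij_def)
qed

text \<open>
  The pairs at which the norm \<open>\<rho>\<close> of the projection \<open>x \<mapsto> x - f x \<cdot> u\<close> is attained. Replacing \<open>(g, x)\<close>
  by \<open>(-g, -x)\<close> changes nothing but the sign of \<open>f x\<close>; requiring \<open>f x \<le> 0\<close> picks the representative for
  which all later weights are nonnegative.
\<close>
definition extremal_pair ::
  "('a::real_normed_vector \<Rightarrow> real) \<Rightarrow> 'a \<Rightarrow> real \<Rightarrow> ('a \<Rightarrow> real) \<Rightarrow> 'a \<Rightarrow> bool" where
  "extremal_pair f u \<rho> g x \<longleftrightarrow>
    linear g \<and> (\<forall>v. \<bar>g v\<bar> \<le> norm v) \<and> norm x \<le> 1 \<and> f x \<le> 0 \<and> g (x - f x *\<^sub>R u) = \<rho>"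

text \<open>
  The last conclusion is the first-order condition at the projection of least norm: moving \<open>u\<close> by
  \<open>y \<in> ker f = Y\<close> changes \<open>g (x - f x \<cdot> u)\<close> by \<open>- f x \<cdot> g y\<close>, so the gradients are the functionals
  \<open>- f x \<cdot> g\<close> on the plane \<open>Y\<close>. It is \<open>dim Y = 2\<close> that limits the number of pairs to three.
\<close>
lemma extremal_triple:
  fixes Y :: "'a::real_normed_vector set"
  assumes "dim (UNIV :: 'a set) = 3" "subspace Y" "dim Y = 2"
  obtains f :: "'a \<Rightarrow> real" and u \<rho> g1 g2 g3 x1 x2 x3 c1 c2 c3
  where "linear f" "f u = 1" "relative_projection_constant Y \<le> \<rho>"
    and "extremal_pair f u \<rho> g1 x1" "extremal_pair f u \<rho> g2 x2" "extremal_pair f u \<rho> g3 x3"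
    and "0 \<le> c1" "0 \<le> c2" "0 \<le> c3" "c1 + c2 + c3 = 1"
    and "\<And>y. f y = 0 \<Longrightarrow> c1 * f x1 * g1 y + c2 * f x2 * g2 y + c3 * f x3 * g3 y = 0"
proof -
  obtain T :: "(real \<times> real) \<times> real \<Rightarrow> 'a"
    where T: "linear T" "bij T" "\<And>v. T v \<in> Y \<longleftrightarrow> snd v = 0"
    using coordinates_adapted_to_plane[OF assms] by metis
  interpret T: linear T by (rule T)
  define S where "S = inv T"
  have ST: "S (T v) = v" and TS: "T (S x) = x" for v x
    using T(2) by (simp_all add: S_def bij_is_inj bij_is_surj surj_f_inv_f)
  have linS: "linear S"
    by (rule linearI) (metis ST TS T.add, metis ST TS T.scale)
  interpret S: linear S by (rule linS)
  have contT: "continuous_on A T" for A by (rule linear_continuous_on) (simp add: T(1) linear_conv_bounded_linear[symmetric])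
  have T0: "T v = 0 \<longleftrightarrow> v = 0" for v using ST T.zero by metis
  obtain M where M: "\<And>v. norm (T v) \<le> M * norm v" using linear_bounded[OF T(1)] by blast
  obtain m where m: "0 < m" "\<And>v. m * norm v \<le> norm (T v)"
  proof -
    have "continuous_on (sphere 0 1) (\<lambda>v. norm (T v))" by (intro continuous_intros contT)
    moreover have "sphere 0 1 \<noteq> ({} :: ((real \<times> real) \<times> real) set)" by simp
    ultimately obtain z where z: "norm z = 1" "\<And>v. norm v = 1 \<Longrightarrow> norm (T z) \<le> norm (T v)"
      using continuous_attains_inf[OF compact_sphere, of 0 1 "\<lambda>v. norm (T v)"] by auto
    have "norm (T z) * norm v \<le> norm (T v)" for v
    proof (cases "v = 0")
      case False
      then have "norm (T z) \<le> norm (T ((1 / norm v) *\<^sub>R v))" by (intro z(2)) simp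
      with False show ?thesis by (simp add: T.scale field_simps)
    qed (simp add: T.zero)
    moreover have "0 < norm (T z)" using z(1) T0 by auto
    ultimately show thesis using that by blast
  qed
  \<comment> \<open>In coordinates: the dual unit ball \<open>D\<close>, and a half \<open>B\<close> of the unit ball that meets every pair \<open>v, -v\<close>.\<close>
  define D where "D = {g. \<forall>v. g \<bullet> v \<le> norm (T v)}"
  define B where "B = {v. norm (T v) \<le> 1 \<and> snd v \<le> 0}"
  have "compact D"
  proof (rule compact_eq_bounded_closed[THEN iffD2], intro conjI)
    show "bounded D"
    proof (rule boundedI)
      fix g assume "g \<in> D"
      have "norm g * norm g = g \<bullet> g"
        by (simp add: power2_norm_eq_inner flip: power2_eq_square)
      also have "\<dots> \<le> norm (T g)" using \<open>g \<in> D\<close> unfolding D_def by blast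
      also have "\<dots> \<le> M * norm g" by (rule M)
      finally have "norm g * norm g \<le> M * norm g" .
      moreover have "0 \<le> M"
        using order_trans[OF norm_ge_zero M[of "(0, 1)"]] by (simp add: norm_Pair)
      ultimately show "norm g \<le> M" by (cases "norm g = 0") auto
    qed
    show "closed D" unfolding D_def Collect_all_eq
      by (intro closed_INT ballI closed_Collect_le continuous_intros)
  qed
  moreover have "compact B"
  proof (rule compact_eq_bounded_closed[THEN iffD2], intro conjI)
    show "bounded B"
    proof (rule boundedI)
      fix v assume "v \<in> B"
      then have "m * norm v \<le> 1" using m(2)[of v] by (auto simp: B_def)
      then show "norm v \<le> 1 / m" using m(1) by (simp add: field_simps)
    qed
    show "closed B" unfolding B_def
      by (intro closed_Collect_conj closed_Collect_le continuous_intros contT)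
  qed
  ultimately have K: "compact (B \<times> D)" by (rule compact_Times[rotated])
  define a where "a k = snd k \<bullet> (fst k - snd (fst k) *\<^sub>R (0, 1))" for k :: "((real \<times> real) \<times> real) \<times> ((real \<times> real) \<times> real)"
  define b where "b k = - snd (fst k) *\<^sub>R fst (snd k)" for k :: "((real \<times> real) \<times> real) \<times> ((real \<times> real) \<times> real)"
  have ab: "a (x, g) + b (x, g) \<bullet> u = g \<bullet> (x - snd x *\<^sub>R (u, 1))" for x g u
    by (cases x; cases g) (simp add: a_def b_def inner_diff_right inner_Pair algebra_simps)
  have cont: "continuous_on (B \<times> D) a" "continuous_on (B \<times> D) b"
    unfolding a_def b_def by (intro continuous_intros)+
  have pos: "0 < m / norm (T (0, 1))" using m(1) T0[of "(0, 1)"] by (simp add: zero_prod_def)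
  have coercive: "\<exists>k\<in>B \<times> D. m / norm (T (0, 1)) * norm u \<le> b k \<bullet> u" for u
  proof -
    \<comment> \<open>The witness: the unit vector in the direction \<open>- (0, 1)\<close>, and a functional that norms \<open>(u, 0)\<close>.\<close>
    define r where "r = 1 / norm (T (0, 1))"
    have r: "0 < r" "norm (T (0, - r)) = 1"
    proof -
      have "T (0, - r) = (- r) *\<^sub>R T (0, 1)" by (simp flip: T.scale)
      then show "0 < r" "norm (T (0, - r)) = 1"
        using T0[of "(0, 1)"] by (auto simp: r_def zero_prod_def)
    qed
    obtain g where g: "\<And>v. g \<bullet> v \<le> norm (T v)" "g \<bullet> (u, 0) = norm (T (u, 0))"
      using norming_vector_exists[OF T(1)] by blast
    have "r * (m * norm u) \<le> r * norm (T (u, 0))"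
      using m(2)[of "(u, 0)"] r by (intro mult_left_mono) (auto simp: norm_Pair)
    also have "\<dots> = b ((0, - r), g) \<bullet> u"
      using g(2) by (cases g) (simp add: b_def inner_Pair)
    finally show ?thesis
      using r g by (intro bexI[of _ "((0, - r), g)"]) (auto simp: B_def D_def r_def)
  qed
  obtain u \<rho> where max: "\<And>k. k \<in> B \<times> D \<Longrightarrow> a k + b k \<bullet> u \<le> \<rho>"
    and hull: "0 \<in> convex hull (b ` {k \<in> B \<times> D. a k + b k \<bullet> u = \<rho>})"
    by (rule affine_sup_minimiser[OF K cont pos coercive]) (rule that)
  define f where "f x = snd (S x)" for x
  define e where "e = T (u, 1)"
  have linf: "linear f" by (rule linearI) (simp_all add: f_def S.add S.scale)
  interpret f: linear f by (rule linf)
  have fe: "f e = 1" by (simp add: f_def e_def ST)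
  have "0 \<le> \<rho>"
    using max[of "(0, 0)"] by (simp add: ab B_def D_def T.zero)
  define P where "P v = v - f v *\<^sub>R e" for v
  have P_le: "norm (P v) \<le> \<rho> * norm v" for v
  proof (cases "v = 0")
    case False
    \<comment> \<open>Scale \<open>v\<close> to a unit vector, with the sign that puts it into \<open>B\<close>.\<close>
    define s where "s = (if f v \<le> 0 then 1 else - 1 :: real) / norm v"
    have s: "\<bar>s\<bar> = 1 / norm v" "s * f v \<le> 0" using False by (auto simp: s_def divide_le_0_iff mult_le_0_iff)
    define x where "x = S (s *\<^sub>R v)"
    have Tx_snd: "T x = s *\<^sub>R v" "snd x = s * f v" by (simp_all add: x_def TS f_def S.scale T.scale)
    with s have x: "x \<in> B" using False by (simp add: B_def)
    have Tx: "T (x - snd x *\<^sub>R (u, 1)) = s *\<^sub>R P v"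
    proof -
      have "T (x - snd x *\<^sub>R (u, 1)) = T x - snd x *\<^sub>R e"
        by (simp only: T.diff T.scale e_def)
      then show ?thesis by (simp add: Tx_snd P_def scaleR_diff_right)
    qed
    obtain g where g: "\<And>w. g \<bullet> w \<le> norm (T w)"
      "g \<bullet> (x - snd x *\<^sub>R (u, 1)) = norm (T (x - snd x *\<^sub>R (u, 1)))"
      using norming_vector_exists[OF T(1)] by blast
    have "(x, g) \<in> B \<times> D" using x g(1) by (simp add: D_def)
    then have "a (x, g) + b (x, g) \<bullet> u \<le> \<rho>" by (rule max)
    then have "norm (s *\<^sub>R P v) \<le> \<rho>" unfolding ab g(2) Tx .
    then show ?thesis using s(1) False by (simp add: field_simps)
  qed (simp add: P_def f.zero)
  have "projection_onto P Y"
    unfolding projection_onto_def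
  proof (intro conjI ballI)
    show "bounded_linear P"
      by (rule bounded_linear_intro[where K = \<rho>])
        (use P_le in \<open>simp_all add: P_def f.add f.scale algebra_simps\<close>)
    have Y: "y \<in> Y \<longleftrightarrow> f y = 0" for y using T(3)[of "S y"] by (simp add: TS f_def)
    show "range P \<subseteq> Y" by (auto simp: Y P_def f.diff f.scale fe)
    show "P y = y" if "y \<in> Y" for y using that by (simp add: Y P_def)
  qed
  then have "relative_projection_constant Y \<le> onorm P"
    unfolding relative_projection_constant_def
    by (intro cINF_lower bdd_belowI2[where m = 0]) (auto simp: projection_onto_def intro: onorm_pos_le)
  also have "\<dots> \<le> \<rho>" using P_le \<open>0 \<le> \<rho>\<close> by (intro onorm_bound)
  finally have le: "relative_projection_constant Y \<le> \<rho>" .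
  obtain F where F: "finite F" "F \<subseteq> b ` {k \<in> B \<times> D. a k + b k \<bullet> u = \<rho>}" "card F \<le> 3"
      "0 \<in> convex hull F"
    using hull unfolding caratheodory[of "b ` _"] by auto
  have "F \<noteq> {}" using F(4) by auto
  \<comment> \<open>Fewer than three gradients are listed with repetitions.\<close>
  then obtain b1 b2 b3 where "F = {b1, b2, b3}"
  proof -
    have "card F = 1 \<or> card F = 2 \<or> card F = 3"
      using F(1,3) \<open>F \<noteq> {}\<close> card_0_eq[of F] by linarith
    then show thesis using that
      by (auto simp: card_1_singleton_iff card_2_iff card_3_iff) (metis insert_absorb2)+
  qed
  then obtain k1 k2 k3 where k: "{k1, k2, k3} \<subseteq> {k \<in> B \<times> D. a k + b k \<bullet> u = \<rho>}"
      and "F = {b k1, b k2, b k3}" using F(2) by auto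
  with F(4) have "0 \<in> convex hull {b k1, b k2, b k3}" by (simp only:)
  then obtain c1 c2 c3 where c: "0 \<le> c1" "0 \<le> c2" "0 \<le> c3" "c1 + c2 + c3 = 1"
      and c0: "c1 *\<^sub>R b k1 + c2 *\<^sub>R b k2 + c3 *\<^sub>R b k3 = 0"
    unfolding convex_hull_3 mem_Collect_eq by metis
  define G where "G k v = snd k \<bullet> S v" for k :: "((real \<times> real) \<times> real) \<times> ((real \<times> real) \<times> real)" and v
  define X where "X k = T (fst k)" for k :: "((real \<times> real) \<times> real) \<times> ((real \<times> real) \<times> real)"
  have pair: "extremal_pair f e \<rho> (G k) (X k)" if "k \<in> {k1, k2, k3}" for k
    unfolding extremal_pair_def
  proof (intro conjI allI)
    obtain x g where xg: "k = (x, g)" by (cases k)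
    have k': "x \<in> B" "g \<in> D" "a (x, g) + b (x, g) \<bullet> u = \<rho>" using that k xg by auto
    show "linear (G k)" by (rule linearI) (simp_all add: G_def S.add S.scale inner_add_right)
    show "norm (X k) \<le> 1" "f (X k) \<le> 0" using k'(1) by (simp_all add: X_def xg B_def f_def ST)
    show "\<bar>G k v\<bar> \<le> norm v" for v
    proof -
      have "g \<bullet> S v \<le> norm (T (S v))" "g \<bullet> S (- v) \<le> norm (T (S (- v)))"
        using k'(2) unfolding D_def by blast+
      then show ?thesis by (simp add: TS S.neg T.neg G_def xg)
    qed
    have "S (X k - f (X k) *\<^sub>R e) = x - snd x *\<^sub>R (u, 1)"
      by (simp add: X_def xg f_def e_def S.diff S.scale ST)
    then show "G k (X k - f (X k) *\<^sub>R e) = \<rho>" using k'(3) by (simp add: G_def xg ab)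
  qed
  have "c1 * f (X k1) * G k1 y + c2 * f (X k2) * G k2 y + c3 * f (X k3) * G k3 y = 0"
    if "f y = 0" for y
  proof -
    define z where "z = fst (S y)"
    have z: "S y = (z, 0)" using that by (simp add: z_def f_def prod_eq_iff)
    have "f (X k) * G k y = - (b k \<bullet> z)" for k
      by (cases "snd k") (simp add: f_def X_def G_def ST z b_def inner_Pair)
    then have "c1 * f (X k1) * G k1 y + c2 * f (X k2) * G k2 y + c3 * f (X k3) * G k3 y
      = - ((c1 *\<^sub>R b k1 + c2 *\<^sub>R b k2 + c3 *\<^sub>R b k3) \<bullet> z)"
      by (simp add: inner_add_left mult.assoc)
    then show ?thesis by (simp add: c0)
  qed
  moreover have "extremal_pair f e \<rho> (G k1) (X k1)" "extremal_pair f e \<rho> (G k2) (X k2)"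
    "extremal_pair f e \<rho> (G k3) (X k3)" by (rule pair; simp)+
  ultimately show thesis using that[OF linf fe le _ _ _ c] by blast
qed

section \<open>Near-extremal pairs are near sign patterns\<close>

text \<open>
  Since \<open>w t = w (\<mu> + d) / (1 - 2 w)\<close> and \<open>w / (1 - 2 w) \<ge> 9 w - 2\<close> (the tangent at \<open>w = 1/3\<close>), the
  constraint \<open>\<Sum> w\<^sub>i t\<^sub>i = 1\<close> gives \<open>1 \<ge> 3 \<mu> + \<Sum> w\<^sub>i d\<^sub>i / (1 - 2 w\<^sub>i)\<close>. For \<open>\<mu>\<close> near \<open>1/3\<close> this
  leaves only \<open>3 R\<close> for the defects \<open>d\<^sub>i\<close>, and the gap in the tangent inequality keeps the weights near
  \<open>1/3\<close>. The hypotheses are symmetric in the indices, so the conclusions are stated for the first.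
\<close>
lemma weight_bounds:
  fixes w1 w2 w3 t1 t2 t3 d1 d2 d3 \<mu> R :: real
  assumes R: "0 \<le> R" "R \<le> 1 / 99" and \<mu>: "1 / 3 - R \<le> \<mu>"
    and w: "0 \<le> w1" "0 \<le> w2" "0 \<le> w3" "w1 + w2 + w3 = 1"
    and t: "0 \<le> t1" "0 \<le> t2" "0 \<le> t3" "w1 * t1 + w2 * t2 + w3 * t3 = 1"
    and d: "0 \<le> d1" "0 \<le> d2" "0 \<le> d3"
    and eq: "t1 * (1 - 2 * w1) = \<mu> + d1" "t2 * (1 - 2 * w2) = \<mu> + d2" "t3 * (1 - 2 * w3) = \<mu> + d3"
  shows "7 / 25 \<le> w1" "w1 \<le> 19 / 50" "w1 * t1 \<le> 1 / 2" "5 * d1 \<le> 24 * R"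
proof -
  have \<mu>_ge: "32 / 99 \<le> \<mu>" using R \<mu> by simp
  have half: "0 < 1 - 2 * w" if "t * (1 - 2 * w) = \<mu> + d" "0 \<le> t" "0 \<le> d" for t w d
  proof (rule ccontr)
    assume "\<not> 0 < 1 - 2 * w"
    then have "t * (1 - 2 * w) \<le> 0" using that(2) by (intro mult_nonneg_nonpos) auto
    with that \<mu>_ge show False by linarith
  qed
  have tangent: "\<mu> * (9 * w - 2) * (1 - 2 * w) \<le> \<mu> * w" for w
  proof -
    have "\<mu> * w - \<mu> * (9 * w - 2) * (1 - 2 * w) = \<mu> * (2 * (3 * w - 1)\<^sup>2)"
      by (simp add: power2_eq_square algebra_simps)
    moreover have "0 \<le> \<mu> * (2 * (3 * w - 1)\<^sup>2)" using \<mu>_ge by simp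
    ultimately show ?thesis by linarith
  qed
  have wt: "\<mu> * (9 * w - 2) \<le> w * t"
    if "t * (1 - 2 * w) = \<mu> + d" "0 \<le> t" "0 \<le> d" "0 \<le> w" for t w d
  proof -
    have "\<mu> * (9 * w - 2) * (1 - 2 * w) \<le> \<mu> * w" by (rule tangent)
    also have "\<dots> \<le> w * (\<mu> + d)" using that by (simp add: algebra_simps)
    also have "\<dots> = w * t * (1 - 2 * w)" using that by (simp flip: that(1))
    finally show ?thesis using half[OF that(1-3)] by simp
  qed
  have wt1: "w1 * t1 \<le> 1 - \<mu> * (5 - 9 * w1)"
  proof -
    have "\<mu> * (9 * w2 - 2) + \<mu> * (9 * w3 - 2) \<le> w2 * t2 + w3 * t3"
      using wt[OF eq(2) t(2) d(2) w(2)] wt[OF eq(3) t(3) d(3) w(3)] by (rule add_mono)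
    moreover have "\<mu> * (9 * w2 - 2) + \<mu> * (9 * w3 - 2) = \<mu> * (5 - 9 * w1)"
    proof -
      have "(9 * w2 - 2) + (9 * w3 - 2) = 5 - 9 * w1" using w by simp
      then show ?thesis by (metis distrib_left)
    qed
    ultimately show ?thesis using t(4) by linarith
  qed
  have v: "0 < 1 - 2 * w1" by (rule half[OF eq(1) t(1) d(1)])
  have d_eq: "w1 * d1 = w1 * t1 * (1 - 2 * w1) - \<mu> * w1"
    using eq(1) by algebra
  also have "\<dots> \<le> (1 - \<mu> * (5 - 9 * w1)) * (1 - 2 * w1) - \<mu> * w1"
    using mult_right_mono[OF wt1, of "1 - 2 * w1"] v by simp
  finally have up: "w1 * d1 \<le> (1 - \<mu> * (5 - 9 * w1)) * (1 - 2 * w1) - \<mu> * w1" .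
  \<comment> \<open>This is the upper bound on \<open>w1 * d1\<close> combined with \<open>d1 \<ge> 0\<close> and \<open>\<mu> \<ge> 32/99\<close>; the quadratic is positive away from \<open>w1 = 1/3\<close>.\<close>
  have quad: "576 * w1\<^sup>2 - 378 * w1 + 61 \<le> 0"
  proof -
    have "0 \<le> 5 - 18 * w1 + 18 * w1\<^sup>2"
      using zero_le_power2[of "6 * w1 - 3"] by (simp add: power2_eq_square algebra_simps)
    then have "32 / 99 * (5 - 18 * w1 + 18 * w1\<^sup>2) \<le> \<mu> * (5 - 18 * w1 + 18 * w1\<^sup>2)"
      using \<mu>_ge by (rule mult_right_mono[rotated])
    also have "\<dots> \<le> 1 - 2 * w1"
    proof -
      have "0 \<le> w1 * d1" using w d by simp
      with up show ?thesis by (simp add: power2_eq_square algebra_simps)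
    qed
    finally show ?thesis by simp
  qed
  show lo: "7 / 25 \<le> w1"
  proof (rule ccontr)
    assume "\<not> 7 / 25 \<le> w1"
    then have "0 \<le> (25 * w1 - 7) * (14400 * w1 - 5418)" by (intro mult_nonpos_nonpos) auto
    then have "0 \<le> 360000 * w1\<^sup>2 - 236250 * w1 + 37926"
      by (simp add: power2_eq_square algebra_simps)
    with quad show False by linarith
  qed
  show hi: "w1 \<le> 19 / 50"
  proof (rule ccontr)
    assume "\<not> w1 \<le> 19 / 50"
    then have "0 \<le> (50 * w1 - 19) * (28800 * w1 - 7956)" by (intro mult_nonneg_nonneg) auto
    then have "0 \<le> 1440000 * w1\<^sup>2 - 945000 * w1 + 151164"
      by (simp add: power2_eq_square algebra_simps)
    with quad show False by linarith
  qed
  have "32 / 99 * (79 / 50) \<le> \<mu> * (5 - 9 * w1)"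
    using \<mu>_ge hi by (intro mult_mono) auto
  with wt1 show "w1 * t1 \<le> 1 / 2" by simp
  have "w1 * d1 \<le> (1 - \<mu> * (5 - 9 * w1)) * (1 - 2 * w1) - \<mu> * (9 * w1 - 2) * (1 - 2 * w1)"
    using up tangent[of w1] by linarith
  also have "\<dots> = (1 - 3 * \<mu>) * (1 - 2 * w1)" by (simp add: algebra_simps)
  also have "\<dots> \<le> 3 * R * (11 / 25)"
    using \<mu> lo v R by (intro mult_mono) auto
  finally have "w1 * d1 \<le> 3 * R * (11 / 25)" .
  moreover have "7 / 25 * d1 \<le> w1 * d1" using lo d by (intro mult_right_mono) auto
  ultimately show "5 * d1 \<le> 24 * R" using R by simp
qed

text \<open>
  The defect \<open>d\<^sub>1\<close> is a sum of three nonnegative terms with coefficients at least \<open>1/5\<close>, so each of \<open>a\<close>,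
  \<open>b\<close>, \<open>c\<close> is at most \<open>5 d\<^sub>1\<close>.
\<close>
lemma extremal_row_defects:
  fixes w1 w2 w3 t1 t2 t3 d1 d2 d3 \<mu> R a b c :: real
  assumes R: "0 \<le> R" "R \<le> 1 / 99" and \<mu>: "1 / 3 - R \<le> \<mu>"
    and w: "0 \<le> w1" "0 \<le> w2" "0 \<le> w3" "w1 + w2 + w3 = 1"
    and t: "0 \<le> t1" "0 \<le> t2" "0 \<le> t3" "w1 * t1 + w2 * t2 + w3 * t3 = 1"
    and d: "0 \<le> d1" "0 \<le> d2" "0 \<le> d3"
    and eq: "t1 * (1 - 2 * w1) = \<mu> + d1" "t2 * (1 - 2 * w2) = \<mu> + d2" "t3 * (1 - 2 * w3) = \<mu> + d3"
    and abc: "0 \<le> a" "0 \<le> b" "0 \<le> c"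
    and d1: "d1 = (1 - w1 * t1) * a + w2 * t1 * b + w3 * t1 * c"
  shows "a \<le> 24 * R" "b \<le> 24 * R" "c \<le> 24 * R"
proof -
  note b1 = weight_bounds[OF R \<mu> w t d eq]
  have w2: "7 / 25 \<le> w2"
    by (rule weight_bounds[OF R \<mu> w(2,1,3) _ t(2,1,3) _ d(2,1,3) eq(2,1,3)]) (use w t in simp_all)
  have w3: "7 / 25 \<le> w3"
    by (rule weight_bounds[OF R \<mu> w(3,1,2) _ t(3,1,2) _ d(3,1,2) eq(3,1,2)]) (use w t in simp_all)
  have t1: "5 / 7 \<le> t1"
  proof -
    have "t1 * (1 - 2 * w1) \<le> t1 * (11 / 25)" using b1(1) t by (intro mult_left_mono) auto
    moreover have "32 / 99 \<le> \<mu> + d1" using R \<mu> d(1) by linarith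
    ultimately show ?thesis using eq(1) by linarith
  qed
  have "7 / 25 * (5 / 7) \<le> w2 * t1" "7 / 25 * (5 / 7) \<le> w3 * t1"
    using w2 w3 t1 mult_mono[of "7 / 25" w2 "5 / 7" t1] mult_mono[of "7 / 25" w3 "5 / 7" t1]
    by simp_all
  then have "1 / 5 * a \<le> (1 - w1 * t1) * a" "1 / 5 * b \<le> w2 * t1 * b" "1 / 5 * c \<le> w3 * t1 * c"
    using b1(3) abc mult_right_mono[of "1 / 5" "1 - w1 * t1" a]
      mult_right_mono[of "1 / 5" "w2 * t1" b] mult_right_mono[of "1 / 5" "w3 * t1" c]
    by simp_all
  then show "a \<le> 24 * R" "b \<le> 24 * R" "c \<le> 24 * R" using d1 abc b1(4) by linarith+
qed

text \<open>
  For an extremal pair, \<open>g u > 0 > f x\<close>, because \<open>g x - f x \<cdot> g u = \<rho> > 1 \<ge> g x\<close>. Hence the balance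
  condition says that \<open>f\<close> is a positive multiple of a convex combination of the \<open>g\<^sub>i\<close>, with weights
  \<open>w\<^sub>i\<close> proportional to \<open>- c\<^sub>i f x\<^sub>i\<close>; evaluating it at \<open>x\<^sub>i\<close> eliminates \<open>f\<close> from the equation for \<open>\<rho>\<close>
  and leaves the system of equations of \<open>extremal_row_defects\<close>, in which \<open>a\<close>, \<open>b\<close>, \<open>c\<close> are the
  distances of the numbers \<open>g\<^sub>j x\<^sub>i\<close> from \<open>1\<close> or \<open>-1\<close>.
\<close>
lemma extremal_triple_defects:
  fixes f :: "'a::real_normed_vector \<Rightarrow> real"
  assumes f: "linear f" "f u = 1"
    and ext: "extremal_pair f u \<rho> g1 x1" "extremal_pair f u \<rho> g2 x2" "extremal_pair f u \<rho> g3 x3"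
    and c: "0 \<le> c1" "0 \<le> c2" "0 \<le> c3" "c1 + c2 + c3 = 1"
    and bal: "\<And>y. f y = 0 \<Longrightarrow> c1 * f x1 * g1 y + c2 * f x2 * g2 y + c3 * f x3 * g3 y = 0"
    and R: "0 \<le> R" "R \<le> 1 / 99" and \<rho>: "4 / 3 - R \<le> \<rho>"
  shows "g1 x1 \<ge> 1 - 24 * R" "g2 x1 \<le> - (1 - 24 * R)" "g3 x1 \<le> - (1 - 24 * R)"
    and "g2 x2 \<ge> 1 - 24 * R" "g1 x2 \<le> - (1 - 24 * R)" "g3 x2 \<le> - (1 - 24 * R)"
proof -
  have contr: "\<bar>g v\<bar> \<le> norm v" if "extremal_pair f u \<rho> g x" for g x v
    using that by (simp add: extremal_pair_def)
  have ent: "\<bar>g y\<bar> \<le> 1" if "extremal_pair f u \<rho> g x" "extremal_pair f u \<rho> h y" for g h x y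
    using contr[OF that(1), of y] that(2) by (auto simp: extremal_pair_def)
  have eq: "g x = \<rho> + f x * g u" if "extremal_pair f u \<rho> g x" for g x
    using that by (auto simp: extremal_pair_def linear_diff linear_scale)
  have fneg: "f x < 0" and tpos: "0 < g u" if "extremal_pair f u \<rho> g x" for g x
  proof -
    have "f x * g u < 0" using eq[OF that] ent[OF that that] R \<rho> by linarith
    moreover have "f x \<le> 0" using that by (simp add: extremal_pair_def)
    ultimately show "f x < 0" "0 < g u" by (auto simp: mult_less_0_iff)
  qed
  define Q where "Q = c1 * - f x1 + c2 * - f x2 + c3 * - f x3"
  have nonneg: "0 \<le> c1 * - f x1" "0 \<le> c2 * - f x2" "0 \<le> c3 * - f x3"
    using c fneg[OF ext(1)] fneg[OF ext(2)] fneg[OF ext(3)] by (auto intro!: mult_nonneg_nonpos)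
  have Q: "0 < Q"
  proof -
    have "0 < c1 \<or> 0 < c2 \<or> 0 < c3" using c by linarith
    then have "0 < c1 * - f x1 \<or> 0 < c2 * - f x2 \<or> 0 < c3 * - f x3"
      using fneg[OF ext(1)] fneg[OF ext(2)] fneg[OF ext(3)] mult_pos_pos[of _ "- f _"] by auto
    with nonneg show ?thesis unfolding Q_def by linarith
  qed
  define w1 w2 w3 where "w1 = c1 * - f x1 / Q" and "w2 = c2 * - f x2 / Q" and "w3 = c3 * - f x3 / Q"
  have w: "0 \<le> w1" "0 \<le> w2" "0 \<le> w3" "w1 + w2 + w3 = 1"
  proof -
    show "0 \<le> w1" "0 \<le> w2" "0 \<le> w3"
      unfolding w1_def w2_def w3_def by (rule divide_nonneg_pos[OF nonneg(1) Q]
        divide_nonneg_pos[OF nonneg(2) Q] divide_nonneg_pos[OF nonneg(3) Q])+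
    have "w1 + w2 + w3 = Q / Q"
      unfolding w1_def w2_def w3_def Q_def by (simp only: add_divide_distrib)
    with Q show "w1 + w2 + w3 = 1" by simp
  qed
  define C where "C = w1 * g1 u + w2 * g2 u + w3 * g3 u"
  have C: "0 < C"
  proof -
    have "0 < w1 \<or> 0 < w2 \<or> 0 < w3" using w by linarith
    moreover have "0 \<le> w1 * g1 u" "0 \<le> w2 * g2 u" "0 \<le> w3 * g3 u"
      using w tpos[OF ext(1)] tpos[OF ext(2)] tpos[OF ext(3)] by auto
    ultimately show ?thesis
      using tpos[OF ext(1)] tpos[OF ext(2)] tpos[OF ext(3)]
        mult_pos_pos[of w1 "g1 u"] mult_pos_pos[of w2 "g2 u"] mult_pos_pos[of w3 "g3 u"]
      unfolding C_def by linarith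
  qed
  have comb: "w1 * g1 v + w2 * g2 v + w3 * g3 v = C * f v" for v
  proof -
    define y where "y = v - f v *\<^sub>R u"
    have "f y = 0" using f by (simp add: y_def linear_diff linear_scale)
    have "w1 * g1 y + w2 * g2 y + w3 * g3 y
      = - (c1 * f x1 * g1 y + c2 * f x2 * g2 y + c3 * f x3 * g3 y) / Q"
      by (simp add: w1_def w2_def w3_def add_divide_distrib diff_divide_distrib)
    also have "\<dots> = 0" by (simp only: bal[OF \<open>f y = 0\<close>])
    finally have "w1 * g1 y + w2 * g2 y + w3 * g3 y = 0" .
    moreover have "g y = g v - f v * g u" if "extremal_pair f u \<rho> g x" for g x
      using that by (simp add: extremal_pair_def y_def linear_diff linear_scale)
    ultimately have "w1 * (g1 v - f v * g1 u) + w2 * (g2 v - f v * g2 u) + w3 * (g3 v - f v * g3 u) = 0"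
      using ext by metis
    then show ?thesis unfolding C_def by algebra
  qed
  define t1 t2 t3 where "t1 = g1 u / C" and "t2 = g2 u / C" and "t3 = g3 u / C"
  have t: "0 \<le> t1" "0 \<le> t2" "0 \<le> t3" "w1 * t1 + w2 * t2 + w3 * t3 = 1"
  proof -
    show "0 \<le> t1" "0 \<le> t2" "0 \<le> t3"
      using C tpos[OF ext(1)] tpos[OF ext(2)] tpos[OF ext(3)] by (auto simp: t1_def t2_def t3_def)
    have "w1 * t1 + w2 * t2 + w3 * t3 = C / C"
      unfolding t1_def t2_def t3_def C_def by (simp only: add_divide_distrib times_divide_eq_right)
    with C show "w1 * t1 + w2 * t2 + w3 * t3 = 1" by simp
  qed
  have row: "\<rho> = g x - (g u / C) * (w1 * g1 x + w2 * g2 x + w3 * g3 x)"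
    if "extremal_pair f u \<rho> g x" for g x
    using eq[OF that] C by (simp add: comb)
  note rows = row[OF ext(1), folded t1_def] row[OF ext(2), folded t2_def] row[OF ext(3), folded t3_def]
  define d1 where "d1 = (1 - w1 * t1) * (1 - g1 x1) + w2 * t1 * (1 + g2 x1) + w3 * t1 * (1 + g3 x1)"
  define d2 where "d2 = (1 - w2 * t2) * (1 - g2 x2) + w1 * t2 * (1 + g1 x2) + w3 * t2 * (1 + g3 x2)"
  define d3 where "d3 = (1 - w3 * t3) * (1 - g3 x3) + w1 * t3 * (1 + g1 x3) + w2 * t3 * (1 + g2 x3)"
  have "0 \<le> w1 * t1" "0 \<le> w2 * t2" "0 \<le> w3 * t3" using w t by simp_all
  then have wt: "0 \<le> 1 - w1 * t1" "0 \<le> 1 - w2 * t2" "0 \<le> 1 - w3 * t3" using t(4) by linarith+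
  have E: "0 \<le> 1 - g y" "0 \<le> 1 + g y"
    if "extremal_pair f u \<rho> g x" "extremal_pair f u \<rho> h y" for g h x y
    using ent[OF that] by auto
  note E11 = E(1)[OF ext(1) ext(1)] and E22 = E(1)[OF ext(2) ext(2)] and E33 = E(1)[OF ext(3) ext(3)]
    and E21 = E(2)[OF ext(2) ext(1)] and E31 = E(2)[OF ext(3) ext(1)]
    and E12 = E(2)[OF ext(1) ext(2)] and E32 = E(2)[OF ext(3) ext(2)]
    and E13 = E(2)[OF ext(1) ext(3)] and E23 = E(2)[OF ext(2) ext(3)]
  have d: "0 \<le> d1" "0 \<le> d2" "0 \<le> d3"
    unfolding d1_def d2_def d3_def
    by (intro add_nonneg_nonneg mult_nonneg_nonneg w t wt E11 E22 E33 E21 E31 E12 E32 E13 E23)+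
  have de: "t1 * (1 - 2 * w1) = (\<rho> - 1) + d1" "t2 * (1 - 2 * w2) = (\<rho> - 1) + d2"
    "t3 * (1 - 2 * w3) = (\<rho> - 1) + d3"
    using rows w(4) unfolding d1_def d2_def d3_def by algebra+
  have \<mu>: "1 / 3 - R \<le> \<rho> - 1" using \<rho> by simp
  note r1 = extremal_row_defects[OF R \<mu> w t d de E11 E21 E31 d1_def]
  have w': "w2 + w1 + w3 = 1" and t': "w2 * t2 + w1 * t1 + w3 * t3 = 1" using w t by simp_all
  note r2 = extremal_row_defects[OF R \<mu> w(2,1,3) w' t(2,1,3) t' d(2,1,3) de(2,1,3) E22 E12 E32 d2_def]
  show "g1 x1 \<ge> 1 - 24 * R" "g2 x1 \<le> - (1 - 24 * R)" "g3 x1 \<le> - (1 - 24 * R)"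
    and "g2 x2 \<ge> 1 - 24 * R" "g1 x2 \<le> - (1 - 24 * R)" "g3 x2 \<le> - (1 - 24 * R)"
    using r1 r2 by linarith+
qed

section \<open>Projections onto planes that are nearly isometric to a sum-norm plane\<close>

text \<open>
  For \<open>\<eta> = 0\<close>, the coordinates on the span are \<open>\<alpha> = (\<delta> - \<gamma>) / 2\<close> and \<open>\<beta> = - (\<gamma> + \<delta>) / 2\<close>, which extend to
  the whole space and satisfy \<open>|\<alpha> v| + |\<beta> v| = max |\<gamma> v| |\<delta> v| \<le> norm v\<close>. In general \<open>\<alpha>\<close> and \<open>\<beta>\<close> come
  from inverting the \<open>2 \<times> 2\<close> matrix of values of \<open>\<gamma>\<close> and \<open>\<delta>\<close>. In \<open>\<alpha> + \<beta>\<close> the functional \<open>\<delta>\<close> has a coefficient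
  of order \<open>\<eta>\<close>, and so has \<open>\<gamma>\<close> in \<open>\<alpha> - \<beta>\<close>, which bounds \<open>|\<alpha>| + |\<beta>| = max |\<alpha> + \<beta>| |\<alpha> - \<beta>|\<close>.
\<close>
lemma projection_onto_span_of_near_l1_pair:
  fixes \<gamma> \<delta> :: "'a::real_normed_vector \<Rightarrow> real" and x y :: 'a
  assumes lin: "linear \<gamma>" "linear \<delta>"
    and contr: "\<And>v. \<bar>\<gamma> v\<bar> \<le> norm v" "\<And>v. \<bar>\<delta> v\<bar> \<le> norm v"
    and unit: "norm x \<le> 1" "norm y \<le> 1"
    and \<eta>: "\<eta> < 1"
    and \<gamma>: "\<gamma> x \<le> - (1 - \<eta>)" "\<gamma> y \<le> - (1 - \<eta>)"
    and \<delta>: "\<delta> x \<ge> 1 - \<eta>" "\<delta> y \<le> - (1 - \<eta>)"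
  shows "subspace (span {x, y})" "dim (span {x, y}) = 2"
    and "relative_projection_constant (span {x, y}) \<le> (2 - \<eta>) / (2 * (1 - \<eta>)\<^sup>2)"
proof -
  interpret \<gamma>: linear \<gamma> by (rule lin)
  interpret \<delta>: linear \<delta> by (rule lin)
  define p q r s where "p = - \<gamma> x" and "q = - \<gamma> y" and "r = \<delta> x" and "s = - \<delta> y"
  note pqrs = p_def q_def r_def s_def
  have lo: "1 - \<eta> \<le> p" "1 - \<eta> \<le> q" "1 - \<eta> \<le> r" "1 - \<eta> \<le> s"
    using \<gamma> \<delta> by (auto simp: pqrs)
  have hi: "p \<le> 1" "q \<le> 1" "r \<le> 1" "s \<le> 1"
    using contr[of x] contr[of y] unit by (auto simp: pqrs)
  have pos: "0 < p" "0 < q" "0 < r" "0 < s" using lo \<eta> by auto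
  define D where "D = p * s + q * r"
  have D: "0 < D" using pos by (simp add: D_def add_pos_pos)
  define \<alpha> \<beta> where "\<alpha> v = (q * \<delta> v - s * \<gamma> v) / D" and "\<beta> v = - (r * \<gamma> v + p * \<delta> v) / D" for v
  define P where "P v = \<alpha> v *\<^sub>R x + \<beta> v *\<^sub>R y" for v
  have lin\<alpha>: "linear \<alpha>" "linear \<beta>"
    by (auto intro!: linearI simp: \<alpha>_def \<beta>_def \<gamma>.add \<delta>.add \<gamma>.scale \<delta>.scale add_divide_distrib
        diff_divide_distrib algebra_simps)
  interpret \<alpha>: linear \<alpha> by (rule lin\<alpha>)
  interpret \<beta>: linear \<beta> by (rule lin\<alpha>)
  have dual: "\<alpha> x = 1" "\<alpha> y = 0" "\<beta> x = 0" "\<beta> y = 1"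
    using D by (auto simp: \<alpha>_def \<beta>_def pqrs D_def field_simps)
  let ?B = "(2 - \<eta>) / (2 * (1 - \<eta>)\<^sup>2)"
  have bound: "\<bar>a * g - b * d\<bar> \<le> ?B * D * n"
    if ab: "2 * (1 - \<eta>) \<le> a" "\<bar>b\<bar> \<le> \<eta>" "(1 - \<eta>) * a \<le> D"
      and gd: "\<bar>g\<bar> \<le> n" "\<bar>d\<bar> \<le> n" for a b g d n
  proof -
    have n: "0 \<le> n" using gd by linarith
    have "\<eta> * (2 * (1 - \<eta>)) \<le> \<eta> * a" using ab by (intro mult_left_mono) auto
    then have "a + \<eta> \<le> (2 - \<eta>) * a / (2 * (1 - \<eta>))"
      using \<eta> by (simp add: pos_le_divide_eq algebra_simps)
    also have "\<dots> = ?B * ((1 - \<eta>) * a)"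
      using \<eta> by (simp add: power2_eq_square)
    also have "\<dots> \<le> ?B * D"
      using ab \<eta> by (intro mult_left_mono) auto
    finally have *: "a + \<eta> \<le> ?B * D" .
    have "\<bar>a * g - b * d\<bar> \<le> \<bar>a\<bar> * \<bar>g\<bar> + \<bar>b\<bar> * \<bar>d\<bar>"
      by (metis abs_mult abs_triangle_ineq4)
    also have "\<dots> \<le> a * n + \<eta> * n"
      using ab gd \<eta> n by (intro add_mono mult_mono) auto
    also have "\<dots> \<le> ?B * D * n"
      using mult_right_mono[OF * n] by (simp add: algebra_simps)
    finally show ?thesis .
  qed
  have P_le: "norm (P v) \<le> ?B * norm v" for v
  proof -
    have "(1 - \<eta>) * (r + s) \<le> D" "(1 - \<eta>) * (p + q) \<le> D"
      using mult_right_mono[OF lo(1), of s] mult_right_mono[OF lo(2), of r]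
        mult_right_mono[OF lo(3), of q] mult_right_mono[OF lo(4), of p] pos
      by (simp_all add: D_def algebra_simps)
    then have "\<bar>(r + s) * \<gamma> v - (q - p) * \<delta> v\<bar> \<le> ?B * D * norm v"
      and "\<bar>(p + q) * \<delta> v - (s - r) * \<gamma> v\<bar> \<le> ?B * D * norm v"
      using lo hi contr
        bound[of "r + s" "q - p" "\<gamma> v" "norm v" "\<delta> v"]
        bound[of "p + q" "s - r" "\<delta> v" "norm v" "\<gamma> v"]
      by auto
    moreover have "(r + s) * \<gamma> v - (q - p) * \<delta> v = (\<alpha> v + \<beta> v) * (- D)"
      and "(p + q) * \<delta> v - (s - r) * \<gamma> v = (\<alpha> v - \<beta> v) * D"
      using D by (simp_all add: \<alpha>_def \<beta>_def field_simps)
    ultimately have "\<bar>\<alpha> v + \<beta> v\<bar> * D \<le> ?B * norm v * D" "\<bar>\<alpha> v - \<beta> v\<bar> * D \<le> ?B * norm v * D"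
      using D by (simp_all add: abs_mult mult_ac)
    then have "\<bar>\<alpha> v\<bar> + \<bar>\<beta> v\<bar> \<le> ?B * norm v"
      using D unfolding mult_le_cancel_right by linarith
    moreover have "norm (P v) \<le> \<bar>\<alpha> v\<bar> * norm x + \<bar>\<beta> v\<bar> * norm y"
      unfolding P_def by (metis norm_scaleR norm_triangle_ineq)
    moreover have "\<dots> \<le> \<bar>\<alpha> v\<bar> + \<bar>\<beta> v\<bar>"
      using unit by (intro add_mono mult_left_le) auto
    ultimately show ?thesis by linarith
  qed
  have linP: "linear P"
    by (auto intro!: linearI simp: P_def \<alpha>.add \<beta>.add \<alpha>.scale \<beta>.scale algebra_simps)
  have P_proj: "projection_onto P (span {x, y})"
    unfolding projection_onto_def
  proof (intro conjI ballI)
    show "bounded_linear P"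
      using linP P_le by (intro bounded_linear_intro[where K = ?B])
        (auto simp: linear_add linear_scale mult.commute)
    show "range P \<subseteq> span {x, y}"
      unfolding P_def by (intro image_subsetI span_add span_scale span_base) auto
    fix z assume "z \<in> span {x, y}"
    moreover have "P x = x" "P y = y" by (simp_all add: P_def dual)
    ultimately show "P z = z"
      by (induction rule: span_induct_alt)
        (auto simp: linear_0[OF linP] linear_add[OF linP] linear_scale[OF linP])
  qed
  have "relative_projection_constant (span {x, y}) \<le> onorm P"
    unfolding relative_projection_constant_def using P_proj
    by (intro cINF_lower bdd_belowI2[where m = 0])
      (auto simp: projection_onto_def intro: onorm_pos_le)
  also have "\<dots> \<le> ?B"
    by (rule onorm_bound) (use P_le \<eta> in auto)
  finally show "relative_projection_constant (span {x, y}) \<le> ?B" .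
  have "x \<noteq> y" using dual by auto
  have "y \<noteq> 0" using dual(4) by (auto simp: \<beta>.zero)
  moreover have "x \<notin> span {y}" using dual(1,2) by (auto simp: span_singleton \<alpha>.scale)
  ultimately have "independent {x, y}" by (simp add: independent_insert)
  with \<open>x \<noteq> y\<close> show "dim (span {x, y}) = 2" by (simp add: dim_eq_card_independent)
qed (rule subspace_span)

theorem theorem3p5:
  fixes Y :: "'a::real_normed_vector set" and R :: real
  assumes "dim (UNIV :: 'a set) = 3"
    and "subspace Y" and "dim Y = 2"
    and "0 \<le> R" and "R < 1 / 3"
    and "relative_projection_constant Y = 4 / 3 - R"
    and "R + phi R < 1 / 3"
  shows "\<exists>Z :: 'a set. subspace Z \<and> dim Z = 2 \<and>
    relative_projection_constant Z \<le> 1 + 9 * (R + phi R) / (4 - 12 * (R + phi R))"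
proof -
  have phi: "33 * R \<le> phi R" using phi_ge_linear assms by blast
  then have R: "R \<le> 1 / 102" using assms by linarith
  define \<epsilon> where "\<epsilon> = R + phi R"
  have \<epsilon>: "34 * R \<le> \<epsilon>" "0 \<le> \<epsilon>" "\<epsilon> < 1 / 3" using phi assms by (auto simp: \<epsilon>_def)
  obtain f :: "'a \<Rightarrow> real" and u \<rho> g1 g2 g3 x1 x2 x3 c1 c2 c3
    where lin: "linear f" "f u = 1" and \<rho>: "relative_projection_constant Y \<le> \<rho>"
    and ext: "extremal_pair f u \<rho> g1 x1" "extremal_pair f u \<rho> g2 x2" "extremal_pair f u \<rho> g3 x3"
    and c: "0 \<le> c1" "0 \<le> c2" "0 \<le> c3" "c1 + c2 + c3 = 1"
    and bal: "\<And>y. f y = 0 \<Longrightarrow> c1 * f x1 * g1 y + c2 * f x2 * g2 y + c3 * f x3 * g3 y = 0"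
    by (rule extremal_triple[OF assms(1-3)]) (rule that)
  have R99: "R \<le> 1 / 99" using R by simp
  have \<rho>': "4 / 3 - R \<le> \<rho>" using \<rho> assms(6) by simp
  note defects = extremal_triple_defects[OF lin ext c bal assms(4) R99 \<rho>']
  define \<eta> where "\<eta> = 24 * R"
  have \<eta>: "0 \<le> \<eta>" "\<eta> \<le> 4 / 17" using assms(4) R by (auto simp: \<eta>_def)
  have g: "linear g1" "linear g3" "\<And>v. \<bar>g1 v\<bar> \<le> norm v" "\<And>v. \<bar>g3 v\<bar> \<le> norm v"
    "norm x1 \<le> 1" "norm x2 \<le> 1"
    using ext by (auto simp: extremal_pair_def)
  have "\<eta> < 1" using \<eta> by simp
  note Z = projection_onto_span_of_near_l1_pair[OF g(2,1,4,3,5,6) this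
      defects(3,6,1,5)[folded \<eta>_def]]
  \<comment> \<open>For \<open>\<eta> = 24 R\<close> the increment \<open>3 \<eta> = 72 R\<close> stays below \<open>9 \<epsilon> / 4\<close>, because \<open>\<epsilon> \<ge> 34 R\<close>.\<close>
  have "(2 - \<eta>) / (2 * (1 - \<eta>)\<^sup>2) \<le> 1 + 3 * \<eta>"
  proof -
    have "0 \<le> \<eta> * (3 - 10 * \<eta> + 6 * \<eta>\<^sup>2)"
      using \<eta> by (intro mult_nonneg_nonneg add_nonneg_nonneg) auto
    then have "2 - \<eta> \<le> (1 + 3 * \<eta>) * (2 * (1 - \<eta>)\<^sup>2)"
      by (simp add: power2_eq_square algebra_simps)
    moreover have "0 < 2 * (1 - \<eta>)\<^sup>2" using \<open>\<eta> < 1\<close> by simp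
    ultimately show ?thesis by (rule pos_divide_le_eq[THEN iffD2, rotated])
  qed
  also have "3 * \<eta> \<le> 9 * \<epsilon> / 4" using \<epsilon> by (simp add: \<eta>_def)
  also have "9 * \<epsilon> / 4 \<le> 9 * \<epsilon> / (4 - 12 * \<epsilon>)"
    using \<epsilon> by (intro divide_left_mono) auto
  finally show ?thesis using Z unfolding \<epsilon>_def by (intro exI[of _ "span {x1, x2}"]) auto
qed

end
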